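(* Let $\mathbf{A}\in\mathbb{C}^{n\times n}$ with $\operatorname{Ind}\mathbf{A}=k$ and $\operatorname{rank}\mathbf{A}^{k+1}=\operatorname{rank}\mathbf{A}^{k}=r$, where $1\le r\le n$, and let $\mathbf{B}\in\mathbb{C}^{n\times m}$. Put $\hat{\mathbf{B}}=\mathbf{A}^{k}\mathbf{B}\in\mathbb{C}^{n\times m}$ and let $\hat{\mathbf{b}}_{.j}$ be its $j$th column. Then the Drazin inverse solution $\mathbf{X}=\mathbf{A}^{D}\mathbf{B}=(x_{ij})\in\mathbb{C}^{n\times m}$ of the matrix equation $\mathbf{A}\mathbf{X}=\mathbf{B}$ satisfies $$x_{ij}=\frac{\sum_{\beta\in J_{r,n}\{i\}}\left|\left(\mathbf{A}^{k+1}_{.i}\left(\hat{\mathbf{b}}_{.j}\right)\right)^{\beta}_{\beta}\right|}{\sum_{\beta\in J_{r,n}}\left|\left(\mathbf{A}^{k+1}\right)^{\beta}_{\beta}\right|}$$ for all $i=1,\dots,n$ and $j=1,\dots,m$.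
   Context: For $\mathbf{A}\in\mathbb{C}^{n\times n}$, the index $\operatorname{Ind}\mathbf{A}$ is the smallest nonnegative integer $k$ with $\operatorname{rank}\mathbf{A}^{k+1}=\operatorname{rank}\mathbf{A}^{k}$. The Drazin inverse $\mathbf{A}^{D}$ of a matrix with $\operatorname{Ind}\mathbf A=k$ is the unique matrix $\mathbf{X}$ satisfying $\mathbf{A}^{k+1}\mathbf{X}=\mathbf{A}^{k}$, $\mathbf{X}\mathbf{A}\mathbf{X}=\mathbf{X}$, $\mathbf{A}\mathbf{X}=\mathbf{X}\mathbf{A}$. The "Drazin inverse solution" of $\mathbf{A}\mathbf{X}=\mathbf{B}$ means, by definition, the matrix $\mathbf{A}^{D}\mathbf{B}$. Notation: for a matrix $\mathbf{M}$ and a column vector $\mathbf{b}$, $\mathbf{M}_{.i}(\mathbf{b})$ is the matrix obtained from $\mathbf{M}$ by replacing its $i$th column with $\mathbf{b}$; $\mathbf{A}^{k+1}_{.i}(\mathbf{b})$ means $(\mathbf{A}^{k+1})_{.i}(\mathbf{b})$. $|\mathbf{M}^{\beta}_{\beta}|$ is the principal minor of $\mathbf{M}$ with rows and columns indexed by $\beta$. For $1\le r\le n$, $J_{r,n}$ is the set of all strictly increasing sequences of $r$ integers from $\{1,\dots,n\}$ (equivalently, $r$-element subsets), and $J_{r,n}\{i\}=\{\beta\in J_{r,n}: i\in\beta\}$. *)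

theory Defs
  imports
    Complex_Main
    "Jordan_Normal_Form.Determinant"
    "Jordan_Normal_Form.DL_Rank"
    "Jordan_Normal_Form.DL_Submatrix"
begin

text \<open>Rows and columns of a matrix are numbered from 0, so the index set
  \<open>{1,...,n}\<close> of the mathematical text becomes \<open>{0..<n}\<close>.\<close>

definition Ind :: "complex mat \<Rightarrow> nat" where
  "Ind A = (LEAST k. vec_space.rank (dim_row A) (A ^\<^sub>m (k + 1)) =
                     vec_space.rank (dim_row A) (A ^\<^sub>m k))"

definition is_drazin_inverse :: "complex mat \<Rightarrow> complex mat \<Rightarrow> bool" where
  "is_drazin_inverse A X \<longleftrightarrow>
     X \<in> carrier_mat (dim_row A) (dim_row A) \<and>
     A ^\<^sub>m (Ind A + 1) * X = A ^\<^sub>m (Ind A) \<and>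
     X * A * X = X \<and>
     A * X = X * A"

definition drazin_inverse :: "complex mat \<Rightarrow> complex mat" where
  "drazin_inverse A = (THE X. is_drazin_inverse A X)"

definition drazin_inverse_solution :: "complex mat \<Rightarrow> complex mat \<Rightarrow> complex mat" where
  "drazin_inverse_solution A B = drazin_inverse A * B"

definition J :: "nat \<Rightarrow> nat \<Rightarrow> nat set set" where
  "J r n = {\<beta>. \<beta> \<subseteq> {0..<n} \<and> card \<beta> = r}"

definition J_at :: "nat \<Rightarrow> nat \<Rightarrow> nat \<Rightarrow> nat set set" where
  "J_at r n i = {\<beta> \<in> J r n. i \<in> \<beta>}"

definition principal_minor :: "'a :: comm_ring_1 mat \<Rightarrow> nat set \<Rightarrow> 'a" where
  "principal_minor M \<beta> = det (submatrix M \<beta> \<beta>)"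

end

theory Submission
  imports Defs
begin

text \<open>Write \<open>A^k = F G\<close> with \<open>F\<close> injective of width \<open>r\<close>. Then \<open>A F = F C\<close>, \<open>G A = C G\<close> and
  \<open>G F = C^k\<close>, where \<open>C\<close> is invertible because the rank does not drop at the next power; hence
  \<open>F C^(-(k+1)) G\<close> is the Drazin inverse and every column \<open>x\<close> of the solution lies in the image of
  \<open>F\<close>. Put \<open>M = A^(k+1)\<close>. Cramer's rule for the polynomial system
  \<open>(t I + M) x = t x + M x\<close>, compared at the coefficient of \<open>t^(n-r)\<close>, is the claimed formula up to
  minors of order \<open>r + 1\<close> of \<open>M\<close> with a column replaced by \<open>x\<close>. These vanish since that matrix
  still factors through dimension \<open>r\<close>. The denominator is \<open>det C^(k+1)\<close> by Sylvester's identity.\<close>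

section \<open>Determinant of a diagonal matrix plus \<open>M\<close> in terms of principal
  minors\<close>

lemma bij_betw_pick:
  assumes "finite S"
  shows "bij_betw (pick S) {0..<card S} S"
proof -
  have "inj_on (pick S) {0..<card S}"
    by (rule inj_onI) (metis atLeastLessThan_iff card_pick_le)
  moreover have "pick S ` {0..<card S} \<subseteq> S"
    using pick_in_set_le by auto
  ultimately show ?thesis
    using assms by (simp add: bij_betw_def card_image card_subset_eq)
qed

text \<open>The Leibniz formula for the submatrix is transported along the enumeration
  \<open>pick \<beta>\<close>. Indexing by permutations of \<beta> itself lets minors be recognised
  inside the permutation sum of a larger determinant without renumbering.\<close>

lemma principal_minor_permutes:
  assumes M: "M \<in> carrier_mat n n" and \<beta>: "\<beta> \<subseteq> {0..<n}"
  shows "principal_minor M \<beta> =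
    (\<Sum>p | p permutes \<beta>. signof p * (\<Prod>i\<in>\<beta>. M $$ (i, p i)))"
proof -
  let ?s = "card \<beta>"
  have fin: "finite \<beta>"
    using \<beta> finite_subset by blast
  have idx: "{i. i < n \<and> i \<in> \<beta>} = \<beta>"
    using \<beta> by auto
  have bij: "bij_betw (pick \<beta>) {0..<?s} \<beta>"
    using fin by (rule bij_betw_pick)
  have sub: "submatrix M \<beta> \<beta> = mat ?s ?s (\<lambda>(i, j). M $$ (pick \<beta> i, pick \<beta> j))"
    using M by (simp add: submatrix_def idx)
  let ?map = "map_permutation {0..<?s} (pick \<beta>)"
  have term_eq: "signof p * (\<Prod>i = 0..<?s. submatrix M \<beta> \<beta> $$ (i, p i)) =
      signof (?map p) * (\<Prod>i\<in>\<beta>. M $$ (i, ?map p i))" if p: "p permutes {0..<?s}" for p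
  proof -
    have "(\<Prod>i\<in>\<beta>. M $$ (i, ?map p i)) =
        (\<Prod>i = 0..<?s. M $$ (pick \<beta> i, ?map p (pick \<beta> i)))"
      using prod.reindex_bij_betw[OF bij, of "\<lambda>i. M $$ (i, ?map p i)"] by simp
    also have "\<dots> = (\<Prod>i = 0..<?s. submatrix M \<beta> \<beta> $$ (i, p i))"
    proof (rule prod.cong)
      fix i assume i: "i \<in> {0..<?s}"
      have "p i \<in> {0..<?s}"
        using p i by (simp only: permutes_in_image)
      then show "M $$ (pick \<beta> i, ?map p (pick \<beta> i)) = submatrix M \<beta> \<beta> $$ (i, p i)"
        using i bij by (simp add: sub map_permutation_apply bij_betw_imp_inj_on)
    qed simp
    finally show ?thesis
      using sign_map_permutation[OF bij_betw_imp_inj_on[OF bij] p] by simp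
  qed
  \<comment> \<open>\<open>bij_betw_permutations\<close> is phrased with this explicit conjugation
    map, so \<open>map_permutation\<close> is brought to that form.\<close>
  have map_eq: "?map = (\<lambda>p x. if x \<in> \<beta> then pick \<beta> (p (inv_into {0..<?s} (pick \<beta>) x)) else x)"
    by (intro ext) (simp add: map_permutation_def restrict_id_def bij_betw_imp_surj_on[OF bij])
  have bij': "bij_betw ?map {p. p permutes {0..<?s}} {p. p permutes \<beta>}"
    using bij_betw_permutations[OF bij] by (simp only: map_eq)
  have "principal_minor M \<beta> =
      (\<Sum>p | p permutes {0..<?s}. signof p * (\<Prod>i = 0..<?s. submatrix M \<beta> \<beta> $$ (i, p i)))"
    unfolding principal_minor_def by (rule det_def') (simp add: sub)
  also have "\<dots> = (\<Sum>p | p permutes {0..<?s}. signof (?map p) * (\<Prod>i\<in>\<beta>. M $$ (i, ?map p i)))"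
    by (rule sum.cong) (simp_all add: term_eq)
  also have "\<dots> = (\<Sum>p | p permutes \<beta>. signof p * (\<Prod>i\<in>\<beta>. M $$ (i, p i)))"
    using sum.reindex_bij_betw[OF bij', of "\<lambda>p. signof p * (\<Prod>i\<in>\<beta>. M $$ (i, p i))"] by simp
  finally show ?thesis .
qed

text \<open>Each product in the Leibniz formula is expanded by choosing, in every row, the entry of
  \<open>M\<close> (rows in \<beta>) or the diagonal entry. The diagonal choices survive only where
  \<open>p\<close> fixes the row, so \<open>p\<close> must permute \<beta>.\<close>

lemma det_diag_plus:
  fixes M :: "'a :: comm_ring_1 mat"
  assumes M: "M \<in> carrier_mat n n"
  shows "det (mat n n (\<lambda>(i, j). if i = j then d i else 0) + M) =
    (\<Sum>\<beta>\<in>Pow {0..<n}. (\<Prod>i\<in>{0..<n} - \<beta>. d i) * principal_minor M \<beta>)"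
proof -
  let ?N = "{0..<n}"
  let ?e = "\<lambda>p i. if i = p i then d i else 0"
  have "det (mat n n (\<lambda>(i, j). if i = j then d i else 0) + M) =
      (\<Sum>p | p permutes ?N. signof p * (\<Prod>i\<in>?N. M $$ (i, p i) + ?e p i))"
  proof (subst det_def'[of _ n], use M in simp, intro sum.cong prod.cong arg_cong2[where f = "(*)"] refl)
    fix p i assume "p \<in> {p. p permutes ?N}" "i \<in> ?N"
    moreover from this have "p i \<in> ?N"
      by (simp only: mem_Collect_eq permutes_in_image)
    ultimately show "(mat n n (\<lambda>(i, j). if i = j then d i else 0) + M) $$ (i, p i) =
        M $$ (i, p i) + ?e p i"
      using M by simp
  qed
  also have "\<dots> = (\<Sum>p | p permutes ?N. \<Sum>\<beta>\<in>Pow ?N.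
      signof p * ((\<Prod>i\<in>\<beta>. M $$ (i, p i)) * (\<Prod>i\<in>?N - \<beta>. ?e p i)))"
    by (simp add: prod_add sum_distrib_left)
  also have "\<dots> = (\<Sum>\<beta>\<in>Pow ?N. \<Sum>p | p permutes ?N.
      signof p * ((\<Prod>i\<in>\<beta>. M $$ (i, p i)) * (\<Prod>i\<in>?N - \<beta>. ?e p i)))"
    by (rule sum.swap)
  also have "\<dots> = (\<Sum>\<beta>\<in>Pow ?N. (\<Prod>i\<in>?N - \<beta>. d i) * principal_minor M \<beta>)"
  proof (rule sum.cong)
    fix \<beta> assume "\<beta> \<in> Pow ?N"
    then have \<beta>: "\<beta> \<subseteq> ?N" by simp
    let ?f = "\<lambda>p. signof p * ((\<Prod>i\<in>\<beta>. M $$ (i, p i)) * (\<Prod>i\<in>?N - \<beta>. ?e p i))"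
    have zero: "?f p = 0" if p: "p permutes ?N" "\<not> p permutes \<beta>" for p
    proof -
      \<comment> \<open>A permutation of \<open>?N\<close> that fixes every point outside \<beta>
        would permute \<beta>, so some outside point is moved and its diagonal factor is 0.\<close>
      obtain i where "i \<in> ?N - \<beta>" "p i \<noteq> i"
        using p permutes_superset[OF p(1), of \<beta>] by auto
      then have "(\<Prod>i\<in>?N - \<beta>. ?e p i) = 0"
        by (intro prod_zero) (auto intro!: bexI[of _ i])
      then show ?thesis by simp
    qed
    have "(\<Sum>p | p permutes ?N. ?f p) = (\<Sum>p | p permutes \<beta>. ?f p)"
      using \<beta> by (intro sum.mono_neutral_right)
        (auto simp: finite_permutations zero intro: permutes_subset)
    also have "\<dots> = (\<Sum>p | p permutes \<beta>. (\<Prod>i\<in>?N - \<beta>. d i) *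
        (signof p * (\<Prod>i\<in>\<beta>. M $$ (i, p i))))"
    proof (rule sum.cong)
      fix p assume "p \<in> {p. p permutes \<beta>}"
      then have "(\<Prod>i\<in>?N - \<beta>. ?e p i) = (\<Prod>i\<in>?N - \<beta>. d i)"
        by (intro prod.cong) (auto simp: permutes_not_in)
      then show "?f p = (\<Prod>i\<in>?N - \<beta>. d i) * (signof p * (\<Prod>i\<in>\<beta>. M $$ (i, p i)))"
        by (simp add: ac_simps)
    qed simp
    also have "\<dots> = (\<Prod>i\<in>?N - \<beta>. d i) * principal_minor M \<beta>"
      by (simp add: principal_minor_permutes[OF M \<beta>] sum_distrib_left)
    finally show "(\<Sum>p | p permutes ?N. ?f p) = (\<Prod>i\<in>?N - \<beta>. d i) * principal_minor M \<beta>" .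
  qed simp
  finally show ?thesis .
qed

abbreviation const_mat :: "'a :: comm_ring_1 mat \<Rightarrow> 'a poly mat" where
  "const_mat \<equiv> map_mat (\<lambda>a. [:a:])"

text \<open>The indeterminate stands only at the diagonal places in \<open>T\<close>:
  \<open>UNIV\<close> gives t I, while \<open>UNIV - {i}\<close> describes what remains after column
  \<open>i\<close> has been replaced by constants.\<close>

abbreviation X_mat :: "nat \<Rightarrow> nat set \<Rightarrow> 'a :: comm_ring_1 poly mat" where
  "X_mat n T \<equiv> mat n n (\<lambda>(i, j). if i = j then if i \<in> T then [:0, 1:] else 0 else 0)"

lemma comm_ring_hom_const: "comm_ring_hom (\<lambda>a :: 'a :: comm_ring_1. [:a:])"
  by standard (simp_all add: one_pCons)

lemma principal_minor_const_mat:
  assumes "M \<in> carrier_mat n n" "\<beta> \<subseteq> {0..<n}"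
  shows "principal_minor (const_mat M) \<beta> = [:principal_minor M \<beta>:]"
proof -
  interpret comm_ring_hom "\<lambda>a :: 'a. [:a:]"
    by (rule comm_ring_hom_const)
  have "submatrix (const_mat M) \<beta> \<beta> = const_mat (submatrix M \<beta> \<beta>)"
    using assms by (intro eq_matI) (auto simp: submatrix_def pick_le)
  then show ?thesis
    by (simp add: principal_minor_def hom_det)
qed

text \<open>In \<open>det_diag_plus\<close> the diagonal factor of \<beta> is the power of t with
  exponent \<open>n - card \<beta>\<close>, or 0 if an index outside \<beta> is missing from
  \<open>T\<close>. Hence a single coefficient collects the minors of a single order.\<close>

lemma coeff_det_X_mat_plus:
  fixes M :: "'a :: comm_ring_1 mat"
  assumes M: "M \<in> carrier_mat n n" and s: "s \<le> n"
  shows "coeff (det (X_mat n T + const_mat M)) (n - s) =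
    (\<Sum>\<beta>\<in>{\<beta> \<in> J s n. {0..<n} - T \<subseteq> \<beta>}. principal_minor M \<beta>)"
proof -
  let ?N = "{0..<n}"
  let ?d = "\<lambda>i. if i \<in> T then [:0, 1:] else (0 :: 'a poly)"
  have coeff_term: "coeff ((\<Prod>i\<in>?N - \<beta>. ?d i) * principal_minor (const_mat M) \<beta>) (n - s) =
      (if card \<beta> = s \<and> ?N - T \<subseteq> \<beta> then principal_minor M \<beta> else 0)"
    if \<beta>: "\<beta> \<subseteq> ?N" for \<beta>
  proof (cases "?N - T \<subseteq> \<beta>")
    case True
    have "(\<Prod>i\<in>?N - \<beta>. ?d i) = (\<Prod>i\<in>?N - \<beta>. [:0, 1:])"
      using True by (intro prod.cong) auto
    also have "\<dots> = monom 1 (n - card \<beta>)"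
      using \<beta> by (simp add: card_Diff_subset finite_subset[OF \<beta>] monom_altdef)
    finally have "(\<Prod>i\<in>?N - \<beta>. ?d i) * principal_minor (const_mat M) \<beta> =
        monom (principal_minor M \<beta>) (n - card \<beta>)"
      by (simp add: principal_minor_const_mat[OF M \<beta>] smult_monom)
    moreover have "card \<beta> \<le> n"
      using card_mono[OF _ \<beta>] by simp
    ultimately show ?thesis
      using s True by auto
  next
    case False
    then obtain i where "i \<in> ?N - \<beta>" "i \<notin> T" by blast
    then have "(\<Prod>i\<in>?N - \<beta>. ?d i) = 0"
      by (intro prod_zero) (auto intro!: bexI[of _ i])
    then show ?thesis
      using False by simp
  qed
  have "coeff (det (X_mat n T + const_mat M)) (n - s) =
      (\<Sum>\<beta>\<in>Pow ?N. if card \<beta> = s \<and> ?N - T \<subseteq> \<beta> then principal_minor M \<beta> else 0)"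
    using M by (simp add: det_diag_plus[of _ n] coeff_sum coeff_term)
  also have "\<dots> = (\<Sum>\<beta>\<in>{\<beta> \<in> Pow ?N. card \<beta> = s \<and> ?N - T \<subseteq> \<beta>}. principal_minor M \<beta>)"
    by (intro sum.mono_neutral_cong_right) auto
  also have "{\<beta> \<in> Pow ?N. card \<beta> = s \<and> ?N - T \<subseteq> \<beta>} = {\<beta> \<in> J s n. ?N - T \<subseteq> \<beta>}"
    by (auto simp: J_def)
  finally show ?thesis .
qed

section \<open>Cramer's rule compared coefficient by coefficient\<close>

text \<open>Laplace expansion along column \<open>i\<close>: its cofactors do not see the column
  that is replaced.\<close>

lemma det_replace_col_linear:
  fixes P :: "'a :: comm_ring_1 mat"
  assumes P: "P \<in> carrier_mat n n" and v: "v \<in> carrier_vec n" "w \<in> carrier_vec n" and i: "i < n"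
  shows "det (replace_col P (c \<cdot>\<^sub>v v + w) i) =
    c * det (replace_col P v i) + det (replace_col P w i)"
proof -
  have expand: "det (replace_col P u i) = (\<Sum>j<n. u $ j * cofactor P j i)" for u
  proof -
    have "replace_col P u i \<in> carrier_mat n n"
      using P by (simp add: replace_col_def)
    moreover have "cofactor (replace_col P u i) j i = cofactor P j i" if "j < n" for j
      using P i that unfolding cofactor_def mat_delete_def replace_col_def
      by (intro arg_cong[where f = "\<lambda>A. _ * det A"] eq_matI) auto
    ultimately show ?thesis
      using P i by (subst laplace_expansion_column[OF _ i]) (auto simp: replace_col_def)
  qed
  show ?thesis
    using v by (simp add: expand sum.distrib sum_distrib_left algebra_simps)
qed

lemma coeff_mult_X:
  fixes p :: "'a :: comm_ring_1 poly"
  shows "coeff ([:0, 1:] * p) m = (case m of 0 \<Rightarrow> 0 | Suc l \<Rightarrow> coeff p l)"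
  by (simp add: coeff_pCons)

text \<open>Cramer's rule is used as the identity det(P with column \<open>i\<close> replaced by P
  x) = x_i det P for P = t I + M, valid over any commutative ring. In the coefficient of t^(n-r),
  the extra factor t in front of \<open>x\<close> lowers the degree by one and so produces the
  minors of order \<open>r + 1\<close>.\<close>

lemma sum_minors_replace_col:
  fixes M :: "'a :: comm_ring_1 mat"
  assumes M: "M \<in> carrier_mat n n" and x: "x \<in> carrier_vec n" and i: "i < n" and r: "r \<le> n"
  shows "(\<Sum>\<beta>\<in>J_at (Suc r) n i. principal_minor (replace_col M x i) \<beta>) +
      (\<Sum>\<beta>\<in>J_at r n i. principal_minor (replace_col M (M *\<^sub>v x) i) \<beta>) =
    x $ i * (\<Sum>\<beta>\<in>J r n. principal_minor M \<beta>)"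
proof -
  let ?P = "X_mat n UNIV + const_mat M"
  let ?c = "map_vec (\<lambda>a. [:a:]) :: 'a vec \<Rightarrow> 'a poly vec"
  let ?y = "M *\<^sub>v x"
  interpret comm_ring_hom "\<lambda>a :: 'a. [:a:]"
    by (rule comm_ring_hom_const)
  have P: "?P \<in> carrier_mat n n"
    using M by simp
  have y: "?y \<in> carrier_vec n"
    using M x by simp
  \<comment> \<open>Row \<open>i\<close> has no indeterminate on its diagonal, so exactly the index
    sets containing \<open>i\<close> contribute.\<close>
  have J_at_eq: "{\<beta> \<in> J s n. {0..<n} - (UNIV - {i}) \<subseteq> \<beta>} = J_at s n i" for s
    using i by (auto simp: J_at_def)
  have "X_mat n UNIV *\<^sub>v ?c x = [:0, 1:] \<cdot>\<^sub>v ?c x"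
    using x by (intro eq_vecI) (auto simp: scalar_prod_def if_distrib[where f = "Polynomial.smult _"] cong: if_cong)
  then have "?P *\<^sub>v ?c x = [:0, 1:] \<cdot>\<^sub>v ?c x + ?c ?y"
    using M x by (simp add: add_mult_distrib_mat_vec[of _ n n] mult_mat_vec_hom[OF M x])
  moreover have "det (replace_col ?P (?P *\<^sub>v ?c x) i) = [:x $ i:] * det ?P"
    using x i by (simp add: cramer_lemma_mat[OF P])
  ultimately have "[:x $ i:] * det ?P =
      [:0, 1:] * det (replace_col ?P (?c x) i) + det (replace_col ?P (?c ?y) i)"
    using x y by (simp only: det_replace_col_linear[OF P _ _ i] map_carrier_vec)
  \<comment> \<open>The replacement also overwrites the t at place \<open>(i, i)\<close>.\<close>
  moreover have "replace_col ?P (?c v) i = X_mat n (UNIV - {i}) + const_mat (replace_col M v i)"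
    if "v \<in> carrier_vec n" for v
    using M that by (intro eq_matI) (auto simp: replace_col_def)
  ultimately have eq: "[:x $ i:] * det ?P =
      [:0, 1:] * det (X_mat n (UNIV - {i}) + const_mat (replace_col M x i)) +
      det (X_mat n (UNIV - {i}) + const_mat (replace_col M ?y i))"
    using x y by (simp only:)
  have carrier: "replace_col M v i \<in> carrier_mat n n" for v
    using M by (simp add: replace_col_def)
  have "coeff ([:0, 1:] * det (X_mat n (UNIV - {i}) + const_mat (replace_col M x i))) (n - r) =
      (\<Sum>\<beta>\<in>J_at (Suc r) n i. principal_minor (replace_col M x i) \<beta>)"
  \<comment> \<open>For \<open>r = n\<close> the truncated \<open>n - Suc r\<close> would be wrong;
    there both sides vanish, a multiple of t having no constant term and \<open>Suc r\<close>
    exceeding the number of indices.\<close>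
  proof (cases "r = n")
    case True
    have "\<beta> \<notin> J_at (Suc r) n i" for \<beta>
      using card_mono[of "{0..<n}" \<beta>] True by (auto simp: J_at_def J_def)
    then have "J_at (Suc r) n i = {}"
      by blast
    then show ?thesis
      by (simp only: coeff_mult_X True diff_self_eq_0 nat.case sum.empty)
  next
    case False
    then have "n - r = Suc (n - Suc r)" and Suc_r: "Suc r \<le> n"
      using r by auto
    then have "coeff ([:0, 1:] * p) (n - r) = coeff p (n - Suc r)" for p :: "'a poly"
      by (simp only: coeff_mult_X nat.case)
    then show ?thesis
      by (simp only: coeff_det_X_mat_plus[OF carrier Suc_r] J_at_eq)
  qed
  moreover have "coeff (det (X_mat n (UNIV - {i}) + const_mat (replace_col M ?y i))) (n - r) =
      (\<Sum>\<beta>\<in>J_at r n i. principal_minor (replace_col M ?y i) \<beta>)"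
    by (simp only: coeff_det_X_mat_plus[OF carrier r] J_at_eq)
  moreover have "coeff ([:x $ i:] * det ?P) (n - r) = x $ i * (\<Sum>\<beta>\<in>J r n. principal_minor M \<beta>)"
    using coeff_det_X_mat_plus[OF M r, of UNIV] by simp
  ultimately show ?thesis
    unfolding eq by simp
qed

section \<open>Sylvester's identity and principal minors of products\<close>

text \<open>The block matrix \<open>?K\<close> is made block triangular in two ways, by
  \<open>?R\<close> on the right and by \<open>?L\<close> on the left. The powers of
  \<open>c\<close> avoid a division, since \<open>c\<close> will be the indeterminate.\<close>

lemma sylvester_det:
  fixes F H :: "'a :: idom mat"
  assumes F: "F \<in> carrier_mat n r" and H: "H \<in> carrier_mat r n"
  shows "c ^ r * det (c \<cdot>\<^sub>m 1\<^sub>m n + F * H) = c ^ n * det (c \<cdot>\<^sub>m 1\<^sub>m r + H * F)"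
proof -
  let ?K = "four_block_mat (c \<cdot>\<^sub>m 1\<^sub>m n) (- F) H (1\<^sub>m r)"
  let ?R = "four_block_mat (1\<^sub>m n) (0\<^sub>m n r) (- H) (1\<^sub>m r)"
  let ?L = "four_block_mat (1\<^sub>m n) (0\<^sub>m n r) (- H) (c \<cdot>\<^sub>m 1\<^sub>m r)"
  have K: "?K \<in> carrier_mat (n + r) (n + r)" and R: "?R \<in> carrier_mat (n + r) (n + r)"
    and L: "?L \<in> carrier_mat (n + r) (n + r)"
    by simp_all
  have "?K * ?R = four_block_mat (c \<cdot>\<^sub>m 1\<^sub>m n + F * H) (- F) (0\<^sub>m r n) (1\<^sub>m r)"
    using F H by (subst mult_four_block_mat[where ?n1.0 = n and ?n2.0 = r]) auto
  then have "det ?K * det ?R = det (c \<cdot>\<^sub>m 1\<^sub>m n + F * H)"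
    using F H
    by (simp add: det_mult[OF K R, symmetric] det_four_block_mat_lower_left_zero[of _ n _ r])
  then have det_K: "det ?K = det (c \<cdot>\<^sub>m 1\<^sub>m n + F * H)"
    using H by (simp add: det_four_block_mat_upper_right_zero[of _ n _ r])
  have "?L * ?K = four_block_mat (c \<cdot>\<^sub>m 1\<^sub>m n) (- F) (0\<^sub>m r n) (c \<cdot>\<^sub>m 1\<^sub>m r + H * F)"
    using F H
    by (subst mult_four_block_mat[where ?n1.0 = n and ?n2.0 = r]) (auto simp: comm_add_mat[of _ r r])
  then have "det ?L * det ?K = c ^ n * det (c \<cdot>\<^sub>m 1\<^sub>m r + H * F)"
    using F H
    by (simp add: det_mult[OF L K, symmetric] det_four_block_mat_lower_left_zero[of _ n _ r])
  then show ?thesis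
    using H by (simp add: det_K det_four_block_mat_upper_right_zero[of _ n _ r])
qed

text \<open>Sylvester's identity at \<open>c\<close> = t makes the two determinants agree up to
  powers of t, and their coefficients are the sums of principal minors.\<close>

lemma sum_principal_minors_mult:
  fixes F H :: "'a :: idom mat"
  assumes F: "F \<in> carrier_mat n r" and H: "H \<in> carrier_mat r n" and s: "s \<le> n"
  shows "(\<Sum>\<beta>\<in>J s n. principal_minor (F * H) \<beta>) =
    (if s \<le> r then \<Sum>\<beta>\<in>J s r. principal_minor (H * F) \<beta> else 0)"
proof -
  interpret comm_ring_hom "\<lambda>a :: 'a. [:a:]"
    by (rule comm_ring_hom_const)
  have X_mat: "X_mat m UNIV = [:0, 1:] \<cdot>\<^sub>m (1\<^sub>m m :: 'a poly mat)" for m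
    by (intro eq_matI) auto
  have pow: "pCons 0 1 ^ m = (monom 1 m :: 'a poly)" for m
    by (simp add: monom_altdef)
  have "monom 1 r * det (X_mat n UNIV + const_mat (F * H)) =
      monom 1 n * det (X_mat r UNIV + const_mat (H * F))"
    using sylvester_det[of "const_mat F" n r "const_mat H" "[:0, 1:]"] F H
    by (simp add: X_mat pow mat_hom_mult[OF F H] mat_hom_mult[OF H F])
  \<comment> \<open>This degree becomes \<open>n - s\<close> after removing t^r and
    \<open>r - s\<close> after removing t^n. For \<open>s > r\<close> it lies below
    \<open>n\<close>, so the right side contributes 0.\<close>
  from arg_cong[OF this, of "\<lambda>p. coeff p (n + r - s)"]
  have eq: "(if n + r - s < r then 0
      else coeff (det (X_mat n UNIV + const_mat (F * H))) (n + r - s - r)) =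
    (if n + r - s < n then 0
      else coeff (det (X_mat r UNIV + const_mat (H * F))) (n + r - s - n))"
    by (simp only: coeff_monom_mult mult_1)
  have "coeff (det (X_mat n UNIV + const_mat (F * H))) (n - s) =
      (if s \<le> r then coeff (det (X_mat r UNIV + const_mat (H * F))) (r - s) else 0)"
  proof (cases "s \<le> r")
    case True
    then have "n + r - s - r = n - s" "n + r - s - n = r - s" "\<not> n + r - s < r" "\<not> n + r - s < n"
      using s by auto
    then show ?thesis
      using eq True by (simp only: if_False if_True)
  next
    case False
    then have "n + r - s - r = n - s" "\<not> n + r - s < r" "n + r - s < n"
      using s by auto
    then show ?thesis
      using eq False by (simp only: if_False if_True)
  qed
  then show ?thesis
    using coeff_det_X_mat_plus[of "F * H" n s UNIV] coeff_det_X_mat_plus[of "H * F" r s UNIV] F H s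
    by simp
qed

lemma principal_minor_full:
  assumes "M \<in> carrier_mat n n"
  shows "principal_minor M {0..<n} = det M"
proof -
  have "pick {0..<n} i = i" if "i < n" for i
    using pick_reduce_set[of i n UNIV] that by (simp add: pick_UNIV atLeast0LessThan lessThan_def)
  then have "submatrix M {0..<n} {0..<n} = M"
    using assms by (intro eq_matI) (auto simp: submatrix_def)
  then show ?thesis
    by (simp add: principal_minor_def)
qed

lemma J_full: "J n n = {{0..<n}}"
proof -
  have "\<beta> = {0..<n}" if "\<beta> \<subseteq> {0..<n}" "card \<beta> = n" for \<beta>
    using that by (intro card_subset_eq) auto
  then show ?thesis
    by (auto simp: J_def)
qed

text \<open>The submatrix is itself a product through dimension \<open>r < s\<close>. Its
  determinant is its only principal minor of order \<open>s\<close>, so the preceding sum formula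
  makes it 0.\<close>

lemma principal_minor_mult_eq_0:
  fixes F H :: "'a :: idom mat"
  assumes F: "F \<in> carrier_mat n r" and H: "H \<in> carrier_mat r n"
    and \<beta>: "\<beta> \<in> J s n" and s: "r < s"
  shows "principal_minor (F * H) \<beta> = 0"
proof -
  have idx: "{i. i < n \<and> i \<in> \<beta>} = \<beta>" and card: "card \<beta> = s"
    using \<beta> by (auto simp: J_def)
  let ?F = "submatrix F \<beta> UNIV" and ?H = "submatrix H UNIV \<beta>"
  have F': "?F \<in> carrier_mat s r" and H': "?H \<in> carrier_mat r s"
    using F H by (auto simp: submatrix_def idx card)
  have "pick \<beta> i < n" if "i < s" for i
    using that pick_le[of i n \<beta>] by (simp add: idx card)
  then have "submatrix (F * H) \<beta> \<beta> = ?F * ?H"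
    using F H by (intro eq_matI) (auto simp: submatrix_def idx card scalar_prod_def pick_UNIV)
  then have "principal_minor (F * H) \<beta> = principal_minor (?F * ?H) {0..<s}"
    using principal_minor_full[of "?F * ?H" s] F' H' by (simp add: principal_minor_def)
  also have "\<dots> = 0"
    using sum_principal_minors_mult[OF F' H', of s] s by (simp add: J_full)
  finally show ?thesis .
qed

section \<open>Rank factorization\<close>

lemma exists_right_factor:
  fixes A F :: "'a :: semiring_1 mat"
  assumes A: "A \<in> carrier_mat n nc" and F: "F \<in> carrier_mat n m"
    and ex: "\<And>j. j < nc \<Longrightarrow> \<exists>g\<in>carrier_vec m. F *\<^sub>v g = col A j"
  obtains G where "G \<in> carrier_mat m nc" "A = F * G"
proof -
  obtain g where g: "g j \<in> carrier_vec m" "F *\<^sub>v g j = col A j" if "j < nc" for j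
    using ex by metis
  define G where "G = mat_of_cols m (map g [0..<nc])"
  have G: "G \<in> carrier_mat m nc"
    by (simp add: G_def carrier_matI)
  have "A = F * G"
  proof (rule mat_col_eqI)
    fix j assume "j < dim_col (F * G)"
    then have j: "j < nc" using G by simp
    then have "col G j = g j"
      using g by (simp add: G_def)
    then show "col A j = col (F * G) j"
      using g j by (simp only: col_mult2[OF F G j])
  qed (use A F G in auto)
  with G show thesis by (rule that)
qed

text \<open>The columns of \<open>F\<close> form a maximal independent set of columns of
  \<open>A\<close>, and \<open>G\<close> holds the coordinates of all columns of \<open>A\<close>.
  The matrix \<open>S\<close> of unit vectors selects the columns kept in \<open>F\<close>; it
  records that the image of \<open>F\<close> lies in that of \<open>A\<close>.\<close>

lemma (in vec_space) rank_factorization: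
  assumes A: "A \<in> carrier_mat n nc" and r: "rank A = r"
  obtains F G S where "F \<in> carrier_mat n r" "G \<in> carrier_mat r nc" "S \<in> carrier_mat nc r"
    "A = F * G" "F = A * S" "\<And>v. v \<in> carrier_vec r \<Longrightarrow> F *\<^sub>v v = 0\<^sub>v n \<Longrightarrow> v = 0\<^sub>v r"
proof -
  have cols: "set (cols A) \<subseteq> carrier_vec n"
    using cols_dim A by blast
  obtain U where U: "finite U" "maximal U (\<lambda>T. T \<subseteq> set (cols A) \<and> lin_indpt T)"
    using maximal_exists_superset[of "set (cols A)" "\<lambda>T. T \<subseteq> set (cols A) \<and> lin_indpt T" "{}"]
      finite_lin_indpt2[of "{}"] by auto
  have UA: "U \<subseteq> set (cols A)" and indpt: "lin_indpt U"
    using U(2) by (auto simp: maximal_def)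
  have U_carrier: "U \<subseteq> carrier_vec n"
    using UA cols by blast
  have card: "card U = r"
    using rank_card_indpt[OF A U(2)] r by simp
  obtain us where us: "set us = U" "distinct us"
    using finite_distinct_list[OF U(1)] by blast
  define F where "F = mat_of_cols n us"
  have F: "F \<in> carrier_mat n r"
    using us card by (auto simp: F_def distinct_card intro: carrier_matI)
  have cols_F: "cols F = us"
    using us U_carrier by (simp add: F_def)
  have inj: "v = 0\<^sub>v r" if "v \<in> carrier_vec r" "F *\<^sub>v v = 0\<^sub>v n" for v
    using lin_depI[OF F that(1) _ that(2)] us indpt by (auto simp: cols_F)
  have "\<exists>g\<in>carrier_vec r. F *\<^sub>v g = col A j" if j: "j < nc" for j
  proof -
    have colj: "col A j \<in> set (cols A)"
      using A j by (auto simp: cols_def)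
    have "col A j \<in> span U"
    proof (rule ccontr)
      assume notin: "col A j \<notin> span U"
      then have new: "col A j \<notin> U"
        using span_mem[OF U_carrier] by blast
      have "lin_indpt (U \<union> {col A j})"
        using lin_dep_iff_in_span[OF U_carrier indpt _ new] notin colj cols by blast
      then show False
        using U(2) UA colj new unfolding maximal_def by blast
    qed
    then obtain a where "lincomb a U = col A j"
      using finite_span[OF U(1) U_carrier] by auto
    then have "F *\<^sub>v vec r (\<lambda>i. a (col F i)) = col A j"
      using mat_mult_eq_lincomb[OF F] us by (simp add: cols_F)
    then show ?thesis by (intro bexI) auto
  qed
  then obtain G where G: "G \<in> carrier_mat r nc" "A = F * G"
    using exists_right_factor[OF A F] by blast
  have "\<exists>s\<in>carrier_vec nc. A *\<^sub>v s = col F j" if j: "j < r" for j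
  proof -
    have "col F j \<in> set (cols F)"
      using F j by (auto simp: cols_def)
    then have "col F j \<in> set (cols A)"
      using UA us by (auto simp: cols_F)
    then obtain k where "k < nc" "col F j = col A k"
      using A by (auto simp: cols_def)
    then have "A *\<^sub>v unit_vec nc k = col F j"
      using A by (intro eq_vecI) auto
    then show ?thesis by (intro bexI[of _ "unit_vec nc k"]) auto
  qed
  then obtain S where "S \<in> carrier_mat nc r" "F = A * S"
    using exists_right_factor[OF F A] by blast
  with F G inj show thesis by (intro that) 
qed

section \<open>Matrix algebra and the invertible core of \<open>A\<close>\<close>

lemma mult_mat_assoc_dim:
  fixes P Q R :: "'a :: semiring_0 mat"
  assumes "dim_col P = dim_row Q" "dim_col Q = dim_row R"
  shows "P * Q * R = P * (Q * R)"
  using assms by (intro assoc_mult_mat) auto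

text \<open>Once products are bracketed to the right, a rule for \<open>P * Q\<close> no longer
  matches when a factor follows; this form applies it there.\<close>

lemma mult_mat_reassoc:
  fixes P Q R :: "'a :: semiring_0 mat"
  assumes "P * Q = T" "dim_col P = dim_row Q" "dim_col Q = dim_row R"
  shows "P * (Q * R) = T * R"
  using assms mult_mat_assoc_dim by metis

lemma pow_mat_Suc_left:
  assumes "A \<in> carrier_mat n n"
  shows "A ^\<^sub>m Suc j = A * A ^\<^sub>m j"
proof (induction j)
  case (Suc j)
  then show ?case
    using assms by (simp add: mult_mat_assoc_dim)
qed (use assms in simp)

lemma pow_mat_inverse:
  assumes C: "C \<in> carrier_mat n n" and D: "D \<in> carrier_mat n n" and CD: "C * D = 1\<^sub>m n"
  shows "C ^\<^sub>m j * D ^\<^sub>m j = 1\<^sub>m n"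
proof (induction j)
  case (Suc j)
  have "C ^\<^sub>m Suc j * D ^\<^sub>m Suc j = C ^\<^sub>m j * (C * D) * D ^\<^sub>m j"
    unfolding pow_mat_Suc_left[OF D] using C D by (simp add: mult_mat_assoc_dim)
  then show ?case
    using C Suc by (simp add: CD right_mult_one_mat[of _ n])
qed (use C D in simp)

lemma mult_mat_left_cancel:
  fixes F :: "'a :: comm_ring_1 mat"
  assumes F: "F \<in> carrier_mat n r"
    and inj: "\<And>v. v \<in> carrier_vec r \<Longrightarrow> F *\<^sub>v v = 0\<^sub>v n \<Longrightarrow> v = 0\<^sub>v r"
    and P: "P \<in> carrier_mat r m" and Q: "Q \<in> carrier_mat r m" and eq: "F * P = F * Q"
  shows "P = Q"
proof (rule mat_col_eqI)
  fix j assume "j < dim_col Q"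
  then have j: "j < m" using Q by simp
  have cP: "col P j \<in> carrier_vec r" and cQ: "col Q j \<in> carrier_vec r"
    using P Q by auto
  have "F *\<^sub>v (col P j - col Q j) = col (F * P) j - col (F * Q) j"
    unfolding col_mult2[OF F P j] col_mult2[OF F Q j]
    using F cP cQ by (rule mult_minus_distrib_mat_vec)
  also have "\<dots> = 0\<^sub>v n"
    unfolding eq using F Q by (intro eq_vecI) auto
  finally have "col P j - col Q j = 0\<^sub>v r"
    using cP cQ by (intro inj) auto
  then have "(col P j - col Q j) $ i = 0" if "i < r" for i
    using that by simp
  then show "col P j = col Q j"
    using P Q j by (intro eq_vecI) auto
qed (use P Q in auto)

text \<open>\<open>C\<close> is the matrix of \<open>A\<close> on the image of
  \<open>A ^\<^sub>m k\<close> in the basis given by the columns of \<open>F\<close>. The relations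
  for \<open>G\<close> follow by cancelling the injective \<open>F\<close>.\<close>

lemma core_factorization:
  fixes A :: "'a :: field mat"
  assumes A: "A \<in> carrier_mat n n"
    and rank_Suc: "vec_space.rank n (A ^\<^sub>m Suc k) = r" and rank: "vec_space.rank n (A ^\<^sub>m k) = r"
  obtains F G C D where
    "F \<in> carrier_mat n r" "G \<in> carrier_mat r n" "C \<in> carrier_mat r r" "D \<in> carrier_mat r r"
    "\<And>v. v \<in> carrier_vec r \<Longrightarrow> F *\<^sub>v v = 0\<^sub>v n \<Longrightarrow> v = 0\<^sub>v r"
    "A ^\<^sub>m k = F * G" "A * F = F * C" "G * A = C * G" "G * F = C ^\<^sub>m k"
    "C * D = 1\<^sub>m r" "D * C = 1\<^sub>m r"
proof -
  interpret vec_space "TYPE('a)" n .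
  have Ak: "A ^\<^sub>m j \<in> carrier_mat n n" for j
    using A by (rule pow_carrier_mat)
  obtain F G S where F: "F \<in> carrier_mat n r" and G: "G \<in> carrier_mat r n"
    and S: "S \<in> carrier_mat n r" and FG: "A ^\<^sub>m k = F * G" and FS: "F = A ^\<^sub>m k * S"
    and inj: "\<And>v. v \<in> carrier_vec r \<Longrightarrow> F *\<^sub>v v = 0\<^sub>v n \<Longrightarrow> v = 0\<^sub>v r"
    using rank_factorization[OF Ak rank] by blast
  obtain F' G' S' where F': "F' \<in> carrier_mat n r" and G': "G' \<in> carrier_mat r n"
    and S': "S' \<in> carrier_mat n r" and "A ^\<^sub>m Suc k = F' * G'" and FS': "F' = A ^\<^sub>m Suc k * S'"
    and inj': "\<And>v. v \<in> carrier_vec r \<Longrightarrow> F' *\<^sub>v v = 0\<^sub>v n \<Longrightarrow> v = 0\<^sub>v r"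
    using rank_factorization[OF Ak rank_Suc] by blast
  note dims = carrier_matD[OF A] carrier_matD[OF F] carrier_matD[OF G] carrier_matD[OF S]
    carrier_matD[OF S'] carrier_matD[OF Ak]
  have comm: "A * A ^\<^sub>m k = A ^\<^sub>m k * A"
    using pow_mat_Suc_left[OF A, of k] by simp
  \<comment> \<open>Forced by A F = A A^k S = A^k (A S) = F (G A S).\<close>
  define C where "C = G * (A * S)"
  have C: "C \<in> carrier_mat r r"
    using A G S by (simp add: C_def)
  have "A * F = A ^\<^sub>m k * (A * S)"
    unfolding FS by (simp add: dims mult_mat_reassoc[OF comm] mult_mat_assoc_dim)
  also have "\<dots> = F * C"
    unfolding FG C_def by (simp add: dims mult_mat_assoc_dim)
  finally have AF: "A * F = F * C" .
  have AkF: "A ^\<^sub>m j * F = F * C ^\<^sub>m j" for j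
  proof (induction j)
    case (Suc j)
    have "A ^\<^sub>m Suc j * F = A ^\<^sub>m j * F * C"
      using C by (simp add: dims mult_mat_assoc_dim AF)
    then show ?case
      using C by (simp add: dims mult_mat_assoc_dim Suc)
  qed (use A F C in simp)
  have "F * (G * A) = F * (C * G)"
  proof -
    have "F * (G * A) = A * (F * G)"
      using comm by (simp add: dims FG mult_mat_assoc_dim)
    also have "\<dots> = F * (C * G)"
      using C by (simp add: dims mult_mat_reassoc[OF AF] mult_mat_assoc_dim)
    finally show ?thesis .
  qed
  then have GA: "G * A = C * G"
    using mult_mat_left_cancel[OF F inj, of "G * A" n "C * G"] A G C by simp
  have "F * (G * F) = F * C ^\<^sub>m k"
    using AkF[of k] by (simp add: dims FG mult_mat_assoc_dim)
  then have GF: "G * F = C ^\<^sub>m k"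
    using mult_mat_left_cancel[OF F inj, of "G * F" r "C ^\<^sub>m k"] F G C by simp
  have "A ^\<^sub>m Suc k = F * (C * G)"
    using C by (simp only: pow_mat_Suc_left[OF A] FG) (simp add: dims mult_mat_reassoc[OF AF] mult_mat_assoc_dim)
  \<comment> \<open>The equal ranks enter here: \<open>F'\<close> is injective with the same width
    \<open>r\<close>, so the square factor \<open>C * (G * S')\<close> is injective and
    \<open>C\<close> is invertible.\<close>
  then have F'_eq: "F' = F * (C * (G * S'))"
    using C by (simp add: FS' dims mult_mat_assoc_dim)
  have CGS: "C * (G * S') \<in> carrier_mat r r"
    using C G S' by simp
  have "v = 0\<^sub>v r" if "v \<in> carrier_vec r" "C * (G * S') *\<^sub>v v = 0\<^sub>v r" for v
  proof -
    have "F' *\<^sub>v v = F *\<^sub>v (C * (G * S') *\<^sub>v v)"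
      unfolding F'_eq using F CGS that(1) by (rule assoc_mult_mat_vec)
    also have "\<dots> = 0\<^sub>v n"
      using F by (auto simp: that(2) scalar_prod_def intro!: eq_vecI)
    finally show ?thesis
      by (rule inj'[OF that(1)])
  qed
  then have "det (C * (G * S')) \<noteq> 0"
    using det_0_iff_vec_prod_zero_field[OF CGS] by blast
  then have "det C \<noteq> 0"
    using det_mult[OF C, of "G * S'"] G S' by auto
  then obtain D where D: "D \<in> carrier_mat r r" and "C * D = 1\<^sub>m r" "D * C = 1\<^sub>m r"
    using det_non_zero_imp_unit[OF C, of "()"] by (auto simp: Units_def ring_mat_def)
  from F G C D inj FG AF GA GF this(2,3) show thesis
    by (rule that)
qed

section \<open>The Drazin inverse and the determinantal formula\<close>

text \<open>Inserting a column from the image of \<open>F\<close> preserves the factorization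
  through dimension \<open>r\<close>, which is what kills the minors of order
  \<open>r + 1\<close>.\<close>

lemma replace_col_mult:
  fixes F H :: "'a :: comm_semiring_0 mat"
  assumes "F \<in> carrier_mat n r" "H \<in> carrier_mat r n" "w \<in> carrier_vec r"
  shows "replace_col (F * H) (F *\<^sub>v w) i = F * replace_col H w i"
  using assms by (intro eq_matI) (auto simp: replace_col_def scalar_prod_def)

theorem theorem3p2:
  fixes A B Bhat X :: "complex mat" and n m k r :: nat
  assumes A: "A \<in> carrier_mat n n"
    and B: "B \<in> carrier_mat n m"
    and ind: "Ind A = k"
    and rank_Suc: "vec_space.rank n (A ^\<^sub>m (k + 1)) = r"
    and rank: "vec_space.rank n (A ^\<^sub>m k) = r"
    and r: "1 \<le> r" "r \<le> n"
    and Bhat: "Bhat = A ^\<^sub>m k * B"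
    and X: "X = drazin_inverse_solution A B"
  shows "X \<in> carrier_mat n m \<and>
         (\<Sum>\<beta>\<in>J r n. principal_minor (A ^\<^sub>m (k + 1)) \<beta>) \<noteq> 0 \<and>
         (\<forall>i<n. \<forall>j<m. X $$ (i, j) =
           (\<Sum>\<beta>\<in>J_at r n i. principal_minor (replace_col (A ^\<^sub>m (k + 1)) (col Bhat j) i) \<beta>)
           / (\<Sum>\<beta>\<in>J r n. principal_minor (A ^\<^sub>m (k + 1)) \<beta>))"
proof -
  obtain F G C D where F: "F \<in> carrier_mat n r" and G: "G \<in> carrier_mat r n"
    and C: "C \<in> carrier_mat r r" and D: "D \<in> carrier_mat r r"
    and inj: "\<And>v. v \<in> carrier_vec r \<Longrightarrow> F *\<^sub>v v = 0\<^sub>v n \<Longrightarrow> v = 0\<^sub>v r"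
    and FG: "A ^\<^sub>m k = F * G" and AF: "A * F = F * C" and GA: "G * A = C * G"
    and GF: "G * F = C ^\<^sub>m k" and CD: "C * D = 1\<^sub>m r" and DC: "D * C = 1\<^sub>m r"
    using core_factorization[OF A rank_Suc[unfolded Suc_eq_plus1[symmetric]] rank] by blast
  let ?M = "A ^\<^sub>m (k + 1)" and ?D = "D ^\<^sub>m Suc k"
  let ?H = "C * G"
  \<comment> \<open>Since \<open>G * F = C ^\<^sub>m k\<close>, the power \<open>k + 1\<close> of
    \<open>D\<close> yields \<open>Y * F = F * D\<close>: \<open>Y\<close> inverts \<open>A\<close>
    on the image of \<open>F\<close>.\<close>
  define Y where "Y = F * (?D * G)"
  have D': "?D \<in> carrier_mat r r" and H: "?H \<in> carrier_mat r n"
    using C D G by (auto intro: pow_carrier_mat)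
  have Y: "Y \<in> carrier_mat n n"
    unfolding Y_def using F G D' by (intro mult_carrier_mat)
  note dims = carrier_matD[OF A] carrier_matD[OF F] carrier_matD[OF G] carrier_matD[OF C]
    carrier_matD[OF D]
  note assoc = mult_mat_assoc_dim dims
  have M: "?M = F * ?H"
    by (simp only: pow_mat_Suc_left[OF A] FG Suc_eq_plus1[symmetric])
      (simp add: assoc mult_mat_reassoc[OF AF])
  have HF: "?H * F = C ^\<^sub>m Suc k"
    unfolding pow_mat_Suc_left[OF C] by (simp add: GF assoc)
  have CD_pow: "C ^\<^sub>m Suc k * ?D = 1\<^sub>m r" and DC_pow: "?D * C ^\<^sub>m Suc k = 1\<^sub>m r"
    and DC_k: "D ^\<^sub>m k * C ^\<^sub>m k = 1\<^sub>m r"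
    using C D CD DC by (auto intro: pow_mat_inverse simp del: pow_mat.simps)
  have MY: "?M * Y = A ^\<^sub>m k"
  proof -
    have "?M * Y = F * ((?H * F) * (?D * G))"
      unfolding M Y_def by (simp add: assoc del: pow_mat.simps)
    also have "\<dots> = F * ((C ^\<^sub>m Suc k * ?D) * G)"
      unfolding HF by (simp add: assoc del: pow_mat.simps)
    also have "\<dots> = A ^\<^sub>m k"
      unfolding CD_pow FG using G by simp
    finally show ?thesis .
  qed
  \<comment> \<open>Commutation is obtained by bringing \<open>A * Y\<close> and
    \<open>Y * A\<close> to the same form.\<close>
  have "A * Y = F * (D ^\<^sub>m k * G)"
  proof -
    have "A * Y = F * ((C * D) * (D ^\<^sub>m k * G))"
      unfolding Y_def pow_mat_Suc_left[OF D] by (simp add: assoc mult_mat_reassoc[OF AF])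
    also have "\<dots> = F * (D ^\<^sub>m k * G)"
      unfolding CD using D G by (simp add: left_mult_one_mat[of _ r n] pow_carrier_mat)
    finally show ?thesis .
  qed
  moreover have YA: "Y * A = F * (D ^\<^sub>m k * G)"
  proof -
    have "Y * A = F * (D ^\<^sub>m k * ((D * C) * G))"
      unfolding Y_def by (simp add: assoc GA)
    also have "\<dots> = F * (D ^\<^sub>m k * G)"
      unfolding DC using G by simp
    finally show ?thesis .
  qed
  moreover have "Y * A * Y = Y"
  proof -
    have "Y * A * Y = F * ((D ^\<^sub>m k * (G * F)) * (?D * G))"
      unfolding YA by (simp add: Y_def assoc del: pow_mat.simps)
    also have "\<dots> = Y"
      unfolding GF DC_k Y_def using D' G by (simp add: left_mult_one_mat[of _ r n] del: pow_mat.simps)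
    finally show ?thesis .
  qed
  ultimately have drazin: "is_drazin_inverse A Y"
    using A Y MY by (simp add: is_drazin_inverse_def ind)
  have unique: "Z = Y" if "is_drazin_inverse A Z" for Z
  proof -
    have Z: "Z \<in> carrier_mat n n" and MZ: "?M * Z = A ^\<^sub>m k" and ZAZ: "Z * A * Z = Z"
      and AZ: "A * Z = Z * A"
      using that A by (simp_all add: is_drazin_inverse_def ind)
    \<comment> \<open>Iterating Z = Z A Z = A Z Z puts \<open>Z\<close> into the image of every
      power of \<open>A\<close>, in particular into that of \<open>F\<close>.\<close>
    have range: "\<exists>W\<in>carrier_mat n n. Z = A ^\<^sub>m j * W" for j
    proof (induction j)
      case 0
      then show ?case using A Z by (intro bexI[of _ Z]) auto
    next
      case (Suc j)
      then obtain W where W: "W \<in> carrier_mat n n" "Z = A ^\<^sub>m j * W" by blast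
      have "Z = A * Z * Z"
        using ZAZ by (simp add: AZ)
      also have "\<dots> = A ^\<^sub>m Suc j * (W * Z)"
        using W(1) Z by (subst W(2)) (simp add: pow_mat_Suc_left[OF A] assoc del: pow_mat.simps)
      finally show ?case
        using W(1) Z by (intro bexI[of _ "W * Z"]) auto
    qed
    then obtain W where W: "W \<in> carrier_mat n n" and ZW: "Z = A ^\<^sub>m k * W" by blast
    have GW: "G * W \<in> carrier_mat r n"
      using G W by simp
    have Z_eq: "Z = F * (G * W)"
      using W by (simp add: ZW FG assoc)
    \<comment> \<open>Cancelling \<open>F\<close> in \<open>?M * Z = A ^\<^sub>m k\<close> leaves an
      equation with invertible coefficient, which determines \<open>G * W\<close> and hence
      \<open>Z\<close>.\<close>
    have "F * (C ^\<^sub>m Suc k * (G * W)) = ?M * Z"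
      using W unfolding M Z_eq HF[symmetric] by (simp add: assoc)
    then have "F * (C ^\<^sub>m Suc k * (G * W)) = F * G"
      unfolding MZ FG .
    then have "C ^\<^sub>m Suc k * (G * W) = G"
      by (rule mult_mat_left_cancel[OF F _ mult_carrier_mat[OF pow_carrier_mat[OF C] GW] G, rotated])
        (rule inj)
    then have "?D * G = (?D * C ^\<^sub>m Suc k) * (G * W)"
      using W by (simp add: assoc del: pow_mat.simps)
    then have "?D * G = G * W"
      unfolding DC_pow left_mult_one_mat[OF GW] .
    then show ?thesis
      by (simp only: Z_eq Y_def)
  qed
  have "drazin_inverse A = Y"
    unfolding drazin_inverse_def using drazin unique by (rule the_equality)
  then have X_eq: "X = Y * B"
    by (simp add: X drazin_inverse_solution_def)
  \<comment> \<open>The coordinates of the columns of \<open>X\<close> with respect to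
    \<open>F\<close>.\<close>
  define W where "W = ?D * G * B"
  have W: "W \<in> carrier_mat r m"
    unfolding W_def using D' G B by (intro mult_carrier_mat)
  have XW: "X = F * W"
    unfolding X_eq Y_def W_def using B by (simp add: assoc del: pow_mat.simps)
  have X_carrier: "X \<in> carrier_mat n m"
    using F W by (simp add: XW)
  have "?M * X = Bhat"
    using A B Y unfolding X_eq Bhat MY[symmetric] by (intro assoc_mult_mat[symmetric]) auto
  let ?d = "\<Sum>\<beta>\<in>J r n. principal_minor ?M \<beta>"
  \<comment> \<open>Passing from \<open>F * ?H\<close> to the \<open>r\<close> by \<open>r\<close>
    matrix \<open>?H * F\<close> leaves only one principal minor of order \<open>r\<close>, the full
    determinant.\<close>
  have "?d = det (C ^\<^sub>m Suc k)"
    unfolding M using sum_principal_minors_mult[OF F H r(2)] principal_minor_full[of "?H * F" r] C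
    by (simp add: J_full HF pow_carrier_mat del: pow_mat.simps)
  moreover have "det (C ^\<^sub>m Suc k) * det ?D = 1"
    using det_mult[of "C ^\<^sub>m Suc k" r ?D] C D by (simp add: CD_pow pow_carrier_mat del: pow_mat.simps)
  ultimately have d: "?d \<noteq> 0"
    by auto
  have "X $$ (i, j) * ?d =
      (\<Sum>\<beta>\<in>J_at r n i. principal_minor (replace_col ?M (col Bhat j) i) \<beta>)"
    if i: "i < n" and j: "j < m" for i j
  proof -
    have w: "col W j \<in> carrier_vec r" and x: "col X j \<in> carrier_vec n"
      using W X_carrier by auto
    have "col X j = F *\<^sub>v col W j"
      unfolding XW by (rule col_mult2[OF F W j])
    then have "replace_col ?M (col X j) i = F * replace_col ?H (col W j) i"
      unfolding M using replace_col_mult[OF F H w] by simp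
    moreover have "replace_col ?H (col W j) i \<in> carrier_mat r n"
      using C G by (simp add: replace_col_def)
    ultimately have "(\<Sum>\<beta>\<in>J_at (Suc r) n i. principal_minor (replace_col ?M (col X j) i) \<beta>) = 0"
      using principal_minor_mult_eq_0[OF F] by (intro sum.neutral) (auto simp: J_at_def)
    moreover have "?M *\<^sub>v col X j = col Bhat j"
      unfolding \<open>?M * X = Bhat\<close>[symmetric]
      by (rule col_mult2[OF pow_carrier_mat[OF A] X_carrier j, symmetric])
    ultimately show ?thesis
      using sum_minors_replace_col[of ?M n "col X j" i r] A x i j r X_carrier
      by (simp add: pow_carrier_mat del: pow_mat.simps)
  qed
  then show ?thesis
    using X_carrier d by (simp add: nonzero_eq_divide_eq)
qed

end
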